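(* There exists a domain $D\subset\mathbb{R}^2$ lying in the half-space $\{(x_1,x_2)\in\mathbb{R}^2 : x_2>0\}$ such that the tube domain $T_D=D+i\mathbb{R}^2\subset\mathbb{C}^2$ is not Kobayashi-hyperbolic and such that for all $b\in\mathbb{R}$ and all $k\in\mathbb{N}$ the segment $[-k,k]\times\{b\}$ is not contained in $D$. Moreover, such a domain $D$ can be chosen to have a $C^{\infty}$-smooth boundary.
   Context: A domain is a nonempty connected open set, and $\mathbb{N}=\{1,2,3,\dots\}$. For a domain $D\subset\mathbb{R}^2$, the tube domain with base $D$ is $T_D:=D+i\mathbb{R}^2=\{(z_1,z_2)\in\mathbb{C}^2 : (\operatorname{Re} z_1,\operatorname{Re} z_2)\in D\}$. A connected complex manifold $X$ is Kobayashi-hyperbolic if the Kobayashi pseudodistance on $X$ is a distance. Equivalently, for $X$ endowed with a Riemannian metric: for every point $x\in X$ there exist a neighborhood $U$ of $x$ and a constant $M>0$ such that for all holomorphic maps $f:\Delta\to X$ with $f(0)\in U$ one has $\|df(0)\|<M$, where $\Delta$ is the unit disk in $\mathbb{C}$. *)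

theory Defs
  imports "HOL-Complex_Analysis.Complex_Analysis"
begin

definition tube_domain :: "(real \<times> real) set \<Rightarrow> (complex \<times> complex) set" where
  "tube_domain D = {(z1, z2). (Re z1, Re z2) \<in> D}"

definition holomorphic_disc :: "(complex \<times> complex) set \<Rightarrow> (complex \<Rightarrow> complex \<times> complex) \<Rightarrow> bool" where
  "holomorphic_disc X f \<longleftrightarrow>
     (\<lambda>z. fst (f z)) holomorphic_on ball 0 1 \<and>
     (\<lambda>z. snd (f z)) holomorphic_on ball 0 1 \<and>
     f ` ball 0 1 \<subseteq> X"

text \<open>The Poincare distance of the unit disc, normalised to curvature \<open>-1\<close>.\<close>

definition poincare_dist :: "complex \<Rightarrow> complex \<Rightarrow> real" where
  "poincare_dist a b = 2 * artanh (norm ((a - b) / (1 - cnj a * b)))"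

text \<open>A chain of discs from \<open>x\<close> to \<open>y\<close> in \<open>X\<close>: points \<open>x = p 0, \<dots>, p n = y\<close> of \<open>X\<close> such that
  the disc \<open>f j\<close> takes \<open>a j\<close> to \<open>p j\<close> and \<open>b j\<close> to \<open>p (j + 1)\<close>.\<close>

definition disc_chain ::
  "(complex \<times> complex) set \<Rightarrow> complex \<times> complex \<Rightarrow> complex \<times> complex \<Rightarrow> nat \<Rightarrow>
   (nat \<Rightarrow> complex \<times> complex) \<Rightarrow> (nat \<Rightarrow> complex \<Rightarrow> complex \<times> complex) \<Rightarrow>
   (nat \<Rightarrow> complex) \<Rightarrow> (nat \<Rightarrow> complex) \<Rightarrow> bool" where
  "disc_chain X x y n p f a b \<longleftrightarrow>
     p 0 = x \<and> p n = y \<and> (\<forall>j\<le>n. p j \<in> X) \<and>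
     (\<forall>j<n. holomorphic_disc X (f j) \<and> a j \<in> ball 0 1 \<and> b j \<in> ball 0 1 \<and>
            f j (a j) = p j \<and> f j (b j) = p (Suc j))"

text \<open>Meaningful for \<open>x\<close> and \<open>y\<close> in a connected open set \<open>X\<close>, where chains exist, so that the
  infimum is over a nonempty set of nonnegative reals.\<close>

definition kobayashi_pseudodist ::
  "(complex \<times> complex) set \<Rightarrow> complex \<times> complex \<Rightarrow> complex \<times> complex \<Rightarrow> real" where
  "kobayashi_pseudodist X x y =
     Inf {(\<Sum>j<n. poincare_dist (a j) (b j)) | n p f a b. disc_chain X x y n p f a b}"

text \<open>On a domain, symmetry, the triangle inequality and vanishing on the diagonal are automatic,
  so the pseudodistance is a distance iff it separates points.\<close>

definition kobayashi_hyperbolic :: "(complex \<times> complex) set \<Rightarrow> bool" where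
  "kobayashi_hyperbolic X \<longleftrightarrow>
     (\<forall>x\<in>X. \<forall>y\<in>X. kobayashi_pseudodist X x y = 0 \<longrightarrow> x = y)"

text \<open>\<open>C\<^sup>k\<close> regularity on an open set, by iterated directional derivatives.\<close>

primrec C_k_on :: "nat \<Rightarrow> (real \<times> real) set \<Rightarrow> (real \<times> real \<Rightarrow> real) \<Rightarrow> bool" where
  "C_k_on 0 U r \<longleftrightarrow> continuous_on U r"
| "C_k_on (Suc k) U r \<longleftrightarrow>
     (\<forall>x\<in>U. r differentiable (at x)) \<and>
     (\<forall>v. C_k_on k U (\<lambda>x. frechet_derivative r (at x) v))"

definition C_infinity_on :: "(real \<times> real) set \<Rightarrow> (real \<times> real \<Rightarrow> real) \<Rightarrow> bool" where
  "C_infinity_on U r \<longleftrightarrow> (\<forall>k. C_k_on k U r)"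

text \<open>Near each boundary point, \<open>D\<close> is the sublevel set of a smooth local defining function with
  nonvanishing differential.\<close>

definition smooth_boundary :: "(real \<times> real) set \<Rightarrow> bool" where
  "smooth_boundary D \<longleftrightarrow>
     (\<forall>p\<in>frontier D. \<exists>U r. open U \<and> p \<in> U \<and> C_infinity_on U r \<and>
        (\<forall>x\<in>U. frechet_derivative r (at x) \<noteq> (\<lambda>v. 0)) \<and>
        D \<inter> U = {x \<in> U. r x < 0})"

end

theory Submission
  imports Defs
begin

text \<open>Take for \<open>D\<close> the region between the graphs of \<open>h x = 1 / (1 + (x - 1)\<^sup>2)\<close> and \<open>x \<mapsto> 2 - h (-x)\<close>.
  Since \<open>h 1 = 1\<close>, the two graphs block every horizontal segment over \<open>[-1, 1]\<close>: the points
  \<open>(1, b)\<close> and \<open>(-1, b)\<close> cannot both lie in \<open>D\<close>. But \<open>D\<close> contains the slanted segments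
  \<open>{(t u, 1 + u / 2) | -1 < u < 1}\<close> for all \<open>t \<ge> 0\<close>, so \<open>w \<mapsto> (t w, 1 + w / 2)\<close> is a disc in the tube
  over \<open>D\<close>, with a derivative at \<open>0\<close> that is unbounded in \<open>t\<close>. It carries \<open>(0, 1)\<close> to \<open>(\<i>, 1 + \<i> / (2 t))\<close>
  at small Poincare cost, and the disc \<open>w \<mapsto> (\<i>, 1 + w / 2)\<close> leads back to \<open>(\<i>, 1)\<close>. Hence \<open>(0, 1)\<close> and
  \<open>(\<i>, 1)\<close> have pseudodistance \<open>0\<close>. After clearing denominators the boundary has
  polynomial defining functions.\<close>

section \<open>Smoothness of polynomial functions\<close>

lemma real_polynomial_function_frechet_derivative:
  fixes r :: "'a::euclidean_space \<Rightarrow> real"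
  assumes "real_polynomial_function r"
  shows "real_polynomial_function (\<lambda>x. frechet_derivative r (at x) v)"
  using assms
proof induction
  case (linear f)
  have "frechet_derivative f (at x) = f" for x
    using frechet_derivative_at[OF bounded_linear_imp_has_derivative[OF linear]] by metis
  then show ?case by (simp add: real_polynomial_function.intros)
next
  case (const c)
  then show ?case by (simp add: real_polynomial_function.intros)
next
  case (add f g)
  have "((\<lambda>x. f x + g x) has_derivative
      (\<lambda>v. frechet_derivative f (at x) v + frechet_derivative g (at x) v)) (at x)" for x
    using add differentiable_at_real_polynomial_function
    by (intro has_derivative_add) (auto simp: frechet_derivative_works[symmetric])
  from frechet_derivative_at[OF this, symmetric] show ?case
    using add by (auto intro: real_polynomial_function.intros)
next
  case (mult f g)
  have "((\<lambda>x. f x * g x) has_derivative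
      (\<lambda>v. f x * frechet_derivative g (at x) v + frechet_derivative f (at x) v * g x)) (at x)" for x
    using mult differentiable_at_real_polynomial_function
    by (intro has_derivative_mult) (auto simp: frechet_derivative_works[symmetric])
  from frechet_derivative_at[OF this, symmetric] show ?case
    using mult by (auto intro: real_polynomial_function.intros)
qed

text \<open>Directional derivatives of polynomials are again polynomials, so the induction
  hypothesis for \<open>k\<close> applies to them once \<open>r\<close> is generalised.\<close>

lemma C_infinity_on_real_polynomial_function:
  assumes "real_polynomial_function r"
  shows "C_infinity_on U r"
proof -
  have "C_k_on k U r" for k
    using assms
  proof (induction k arbitrary: r)
    case 0
    then show ?case
      by (simp add: continuous_on_polymonial_function real_polynomial_function_eq)
  next
    case (Suc k)
    show ?case
      unfolding C_k_on.simps
      by (intro conjI ballI allI Suc.IH differentiable_at_real_polynomial_function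
          real_polynomial_function_frechet_derivative Suc.prems)
  qed
  then show ?thesis by (simp add: C_infinity_on_def)
qed

section \<open>Bounds for the Poincare distance and the pseudodistance\<close>

lemma poincare_dist_nonneg:
  assumes "a \<in> ball 0 1" "b \<in> ball 0 1"
  shows "poincare_dist a b \<ge> 0"
proof -
  \<comment> \<open>Up to sign the quotient is a Moebius automorphism of the disc, so its modulus is
    below 1, where \<open>artanh\<close> is given by a logarithm of a number at least 1.\<close>
  have "norm ((a - b) / (1 - cnj a * b)) = norm (Moebius_function 0 a b)"
    by (simp add: Moebius_function_def norm_divide norm_minus_commute)
  also have "\<dots> < 1"
    using assms by (intro Moebius_function_norm_lt_1) auto
  finally show ?thesis
    by (auto simp: poincare_dist_def artanh_def divide_simps intro!: ln_ge_zero)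
qed

lemma poincare_dist_0_left [simp]: "poincare_dist 0 b = 2 * artanh (norm b)"
  and poincare_dist_0_right [simp]: "poincare_dist a 0 = 2 * artanh (norm a)"
  by (simp_all add: poincare_dist_def)

lemma disc_chain_length_nonneg:
  assumes "disc_chain X x y n p f a b"
  shows "(\<Sum>j<n. poincare_dist (a j) (b j)) \<ge> 0"
  using assms by (auto simp: disc_chain_def intro!: sum_nonneg poincare_dist_nonneg)

lemma kobayashi_pseudodist_le:
  assumes "disc_chain X x y n p f a b"
  shows "kobayashi_pseudodist X x y \<le> (\<Sum>j<n. poincare_dist (a j) (b j))"
  unfolding kobayashi_pseudodist_def
  using assms disc_chain_length_nonneg
  by (intro cInf_lower bdd_belowI[of _ 0]) blast+

text \<open>The chain ensures that the infimum is over a nonempty set.\<close>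

lemma kobayashi_pseudodist_nonneg:
  assumes "disc_chain X x y n p f a b"
  shows "kobayashi_pseudodist X x y \<ge> 0"
  unfolding kobayashi_pseudodist_def
  using assms disc_chain_length_nonneg
  by (intro cInf_greatest) blast+

section \<open>The domain and its boundary\<close>

definition lower_fun :: "real \<times> real \<Rightarrow> real" where
  "lower_fun p = 1 - snd p * (1 + (fst p - 1)\<^sup>2)"

definition upper_fun :: "real \<times> real \<Rightarrow> real" where
  "upper_fun p = 1 - (2 - snd p) * (1 + (fst p + 1)\<^sup>2)"

definition bent_strip :: "(real \<times> real) set" where
  "bent_strip = {p. lower_fun p < 0 \<and> upper_fun p < 0}"

lemma lower_fun_neg_iff: "lower_fun (x, y) < 0 \<longleftrightarrow> 1 / (1 + (x - 1)\<^sup>2) < y"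
proof -
  have "1 + (x - 1)\<^sup>2 > 0" by (simp add: add_pos_nonneg)
  then show ?thesis by (simp add: lower_fun_def divide_simps)
qed

lemma upper_fun_neg_iff: "upper_fun (x, y) < 0 \<longleftrightarrow> y < 2 - 1 / (1 + (x + 1)\<^sup>2)"
proof -
  \<comment> \<open>The point reflection in \<open>(0, 1)\<close> exchanges the two boundary
    graphs.\<close>
  have "upper_fun (x, y) = lower_fun (- x, 2 - y)"
    by (simp add: lower_fun_def upper_fun_def power2_eq_square algebra_simps)
  moreover have "(- x - 1)\<^sup>2 = (x + 1)\<^sup>2" by (simp add: power2_eq_square algebra_simps)
  ultimately show ?thesis by (auto simp: lower_fun_neg_iff)
qed

text \<open>Both fractions are at most 1, with equality only at \<open>x = 1\<close> and
  \<open>x = -1\<close> respectively, so their sum stays below 2.\<close>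

lemma lower_graph_less_upper_graph: "1 / (1 + (x - 1)\<^sup>2) < 2 - 1 / (1 + (x + 1)\<^sup>2)" for x :: real
proof -
  have le: "1 / (1 + t\<^sup>2) \<le> 1" "t \<noteq> 0 \<Longrightarrow> 1 / (1 + t\<^sup>2) < 1" for t :: real
    by (simp_all add: divide_simps add_pos_nonneg)
  show ?thesis
    using le[of "x - 1"] le[of "x + 1"] by (cases "x = 1") auto
qed

lemma bent_strip_eq:
  "bent_strip = {(x, y). 1 / (1 + (x - 1)\<^sup>2) < y \<and> y < 2 - 1 / (1 + (x + 1)\<^sup>2)}"
  by (auto simp: bent_strip_def lower_fun_neg_iff upper_fun_neg_iff)

lemma real_polynomial_function_fst [intro]: "real_polynomial_function (fst :: real \<times> real \<Rightarrow> real)"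
  and real_polynomial_function_snd [intro]: "real_polynomial_function (snd :: real \<times> real \<Rightarrow> real)"
  by (intro real_polynomial_function.intros(1) bounded_linear_fst bounded_linear_snd)+

lemma real_polynomial_function_lower_fun: "real_polynomial_function lower_fun"
  and real_polynomial_function_upper_fun: "real_polynomial_function upper_fun"
  unfolding lower_fun_def[abs_def] upper_fun_def[abs_def] power2_eq_square
  by (intro real_polynomial_function_diff real_polynomial_function.intros(2-4)
      real_polynomial_function_fst real_polynomial_function_snd)+

lemma open_lower_fun_neg: "open {p. lower_fun p < 0}"
  and open_upper_fun_neg: "open {p. upper_fun p < 0}"
  unfolding lower_fun_def upper_fun_def by (intro open_Collect_less continuous_intros)+

lemma open_bent_strip: "open bent_strip"
  unfolding bent_strip_def
  using open_Int[OF open_lower_fun_neg open_upper_fun_neg] by (simp add: Int_def)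

text \<open>Linear interpolation between the two graphs maps the straight strip
  \<open>UNIV \<times> {0<..<1}\<close> continuously onto the domain.\<close>

lemma connected_bent_strip: "connected bent_strip"
proof -
  define h g :: "real \<Rightarrow> real" where "h x = 1 / (1 + (x - 1)\<^sup>2)" and "g x = 2 - 1 / (1 + (x + 1)\<^sup>2)" for x
  have hg: "h x < g x" for x
    using lower_graph_less_upper_graph by (simp add: h_def g_def)
  have nz: "1 + t\<^sup>2 \<noteq> 0" for t :: real
    by (smt (verit) zero_le_power2)
  let ?F = "\<lambda>(x, t). (x, h x + t * (g x - h x))"
  have "(x, y) \<in> ?F ` (UNIV \<times> {0<..<1})" if "h x < y" "y < g x" for x y
    using that hg[of x]
    by (intro image_eqI[of _ _ "(x, (y - h x) / (g x - h x))"]) auto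
  moreover have "h x + t * (g x - h x) < g x" if "t < 1" for x t
  proof -
    have "t * (g x - h x) < 1 * (g x - h x)"
      using that hg[of x] by (intro mult_strict_right_mono) auto
    then show ?thesis by simp
  qed
  ultimately have "bent_strip = ?F ` (UNIV \<times> {0<..<1})"
    using hg by (auto simp: bent_strip_eq h_def[symmetric] g_def[symmetric])
  moreover have "connected (?F ` (UNIV \<times> {0<..<1}))"
    unfolding case_prod_unfold h_def g_def using nz
    by (intro connected_continuous_image continuous_intros connected_Times) auto
  ultimately show ?thesis by simp
qed

lemma frechet_derivative_lower_fun_neq_0: "frechet_derivative lower_fun (at x) \<noteq> (\<lambda>v. 0)"
proof -
  have "(lower_fun has_derivative
      (\<lambda>v. - (snd x * (2 * (fst x - 1) * fst v) + snd v * (1 + (fst x - 1)\<^sup>2)))) (at x)"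
    unfolding lower_fun_def[abs_def] by (auto intro!: derivative_eq_intros simp: algebra_simps)
  \<comment> \<open>The boundary curve is a graph over the first axis, so the vertical direction is
    transversal to it.\<close>
  from frechet_derivative_at[OF this, symmetric]
  have "frechet_derivative lower_fun (at x) (0, 1) = - (1 + (fst x - 1)\<^sup>2)" by simp
  moreover have "1 + (fst x - 1)\<^sup>2 > 0" by (simp add: add_pos_nonneg)
  ultimately show ?thesis by auto
qed

lemma frechet_derivative_upper_fun_neq_0: "frechet_derivative upper_fun (at x) \<noteq> (\<lambda>v. 0)"
proof -
  have "(upper_fun has_derivative
      (\<lambda>v. - ((2 - snd x) * (2 * (fst x + 1) * fst v) - snd v * (1 + (fst x + 1)\<^sup>2)))) (at x)"
    unfolding upper_fun_def[abs_def] by (auto intro!: derivative_eq_intros simp: algebra_simps)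
  from frechet_derivative_at[OF this, symmetric]
  have "frechet_derivative upper_fun (at x) (0, 1) = 1 + (fst x + 1)\<^sup>2" by simp
  moreover have "1 + (fst x + 1)\<^sup>2 > 0" by (simp add: add_pos_nonneg)
  ultimately show ?thesis by auto
qed

text \<open>The two graphs are disjoint, so every boundary point satisfies one of the inequalities
  strictly. On the open set where that one holds, the other alone cuts out the domain.\<close>

lemma smooth_boundary_bent_strip: "smooth_boundary bent_strip"
  unfolding smooth_boundary_def
proof
  fix p assume "p \<in> frontier bent_strip"
  then have "p \<notin> bent_strip"
    using open_bent_strip by (simp add: frontier_def interior_open)
  moreover have "lower_fun p < 0 \<or> upper_fun p < 0"
    using lower_graph_less_upper_graph[of "fst p"]
    by (cases p) (auto simp: lower_fun_neg_iff upper_fun_neg_iff)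
  ultimately consider "upper_fun p < 0" | "lower_fun p < 0"
    by (auto simp: bent_strip_def)
  then show "\<exists>U r. open U \<and> p \<in> U \<and> C_infinity_on U r \<and>
      (\<forall>x\<in>U. frechet_derivative r (at x) \<noteq> (\<lambda>v. 0)) \<and> bent_strip \<inter> U = {x \<in> U. r x < 0}"
  proof cases
    case 1
    then show ?thesis
      by (intro exI[of _ "{p. upper_fun p < 0}"] exI[of _ lower_fun])
        (auto simp: open_upper_fun_neg frechet_derivative_lower_fun_neq_0 bent_strip_def
          real_polynomial_function_lower_fun C_infinity_on_real_polynomial_function)
  next
    case 2
    then show ?thesis
      by (intro exI[of _ "{p. lower_fun p < 0}"] exI[of _ upper_fun])
        (auto simp: open_lower_fun_neg frechet_derivative_upper_fun_neq_0 bent_strip_def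
          real_polynomial_function_upper_fun C_infinity_on_real_polynomial_function)
  qed
qed

section \<open>Discs of unbounded derivative and failure of hyperbolicity\<close>

lemma slanted_segment_in_bent_strip:
  assumes "t \<ge> 0" "\<bar>u\<bar> < 1"
  shows "(t * u, 1 + u / 2) \<in> bent_strip"
proof -
  have *: "1 < (1 + v / 2) * (1 + (t * v - 1)\<^sup>2)" if v: "\<bar>v\<bar> < 1" for v
  proof (cases "v > 0")
    case True
    then have "1 * 1 < (1 + v / 2) * 1" by simp
    also have "\<dots> \<le> (1 + v / 2) * (1 + (t * v - 1)\<^sup>2)"
      using True by (intro mult_left_mono) auto
    finally show ?thesis by simp
  next
    \<comment> \<open>For \<open>v \<le> 0\<close> the point lies over the left half-line, where the
      lower graph has height at most 1/2, while \<open>1 + v / 2 > 1/2\<close>.\<close>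
    case False
    then have "t * v \<le> 0" using assms by (simp add: mult_nonneg_nonpos)
    then have "1\<^sup>2 \<le> (1 - t * v)\<^sup>2" by (intro power_mono) auto
    then have "2 \<le> 1 + (t * v - 1)\<^sup>2" by (simp add: power2_commute)
    then have "(1 + v / 2) * 2 \<le> (1 + v / 2) * (1 + (t * v - 1)\<^sup>2)"
      using v by (intro mult_left_mono) auto
    moreover have "1 < (1 + v / 2) * 2" using v by (simp add: abs_less_iff)
    ultimately show ?thesis by linarith
  qed
  \<comment> \<open>By the point reflection, the upper inequality at \<open>u\<close> is the lower
    one at \<open>- u\<close>.\<close>
  have "(t * - u - 1)\<^sup>2 = (t * u + 1)\<^sup>2" by (simp add: power2_eq_square algebra_simps)
  with *[of u] *[of "- u"] assms show ?thesis
    by (simp add: bent_strip_def lower_fun_def upper_fun_def)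
qed

lemma bent_strip_disc_chain:
  assumes "t > 1"
  shows "disc_chain (tube_domain bent_strip) (0, 1) (\<i>, 1) 2
    (\<lambda>j. if j = 0 then (0, 1) else if j = 1 then (\<i>, 1 + \<i> / (2 * of_real t)) else (\<i>, 1))
    (\<lambda>j w. (if j = 0 then of_real t * w else \<i>, 1 + w / 2))
    (\<lambda>j. if j = 0 then 0 else \<i> / of_real t)
    (\<lambda>j. if j = 0 then \<i> / of_real t else 0)"
proof -
  have Re: "\<bar>Re w\<bar> < 1" if "cmod w < 1" for w
    using abs_Re_le_cmod[of w] that by linarith
  \<comment> \<open>Real parts land on the slanted segment with \<open>u = Re w\<close>. The second
    disc uses slope parameter 0, since \<open>Re \<i> = 0\<close>.\<close>
  have discs: "(of_real t * w, 1 + w / 2) \<in> tube_domain bent_strip"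
      "(\<i>, 1 + w / 2) \<in> tube_domain bent_strip" if "cmod w < 1" for w
    using slanted_segment_in_bent_strip[OF _ Re[OF that], of t]
      slanted_segment_in_bent_strip[OF _ Re[OF that], of 0] assms
    by (auto simp: tube_domain_def)
  have t: "cmod (\<i> / of_real t) < 1" using assms by (simp add: norm_divide)
  have "holomorphic_disc (tube_domain bent_strip) (\<lambda>w. (of_real t * w, 1 + w / 2))"
    "holomorphic_disc (tube_domain bent_strip) (\<lambda>w. (\<i>, 1 + w / 2))"
    using assms discs by (auto simp: holomorphic_disc_def intro!: holomorphic_intros)
  then show ?thesis
    using assms t discs[of 0] discs[of "\<i> / of_real t"]
    by (auto simp: disc_chain_def less_2_cases_iff mult.commute)
qed

lemma not_kobayashi_hyperbolic_bent_strip: "\<not> kobayashi_hyperbolic (tube_domain bent_strip)"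
proof -
  let ?d = "kobayashi_pseudodist (tube_domain bent_strip) (0, 1) (\<i>, 1)"
  \<comment> \<open>Each of the two discs joins 0 and \<open>\<i> / t\<close>, at cost
    \<open>2 * artanh (1 / t)\<close>.\<close>
  have "?d \<le> 4 * artanh (1 / t)" if "t > 1" for t :: real
    using kobayashi_pseudodist_le[OF bent_strip_disc_chain[OF that]] that
    by (simp add: numeral_2_eq_2 norm_divide)
  then have "\<forall>\<^sub>F t in at_top. ?d \<le> 4 * artanh (1 / t)"
    by (auto intro: eventually_mono[OF eventually_gt_at_top[of 1]])
  moreover have "((\<lambda>t::real. 4 * artanh (1 / t)) \<longlongrightarrow> 4 * artanh 0) at_top"
    by (intro tendsto_mult tendsto_const tendsto_artanh tendsto_divide_0[OF tendsto_const]
        filterlim_at_top_imp_at_infinity filterlim_ident) auto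
  ultimately have "?d \<le> 4 * artanh 0"
    by (intro tendsto_lowerbound) auto
  moreover have "?d \<ge> 0"
    using kobayashi_pseudodist_nonneg[OF bent_strip_disc_chain[of 2]] by simp
  ultimately have "?d = 0" by simp
  moreover have "(0, 1) \<in> tube_domain bent_strip" "(\<i>, 1) \<in> tube_domain bent_strip"
    using slanted_segment_in_bent_strip[of 0 0] by (auto simp: tube_domain_def)
  moreover have "(0, 1) \<noteq> (\<i>, 1 :: complex)" by simp
  ultimately show ?thesis
    unfolding kobayashi_hyperbolic_def by blast
qed

theorem theorem1p2:
  shows "\<exists>D :: (real \<times> real) set.
           D \<noteq> {} \<and> open D \<and> connected D \<and>
           D \<subseteq> {(x1, x2). x2 > 0} \<and>
           \<not> kobayashi_hyperbolic (tube_domain D) \<and>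
           (\<forall>b :: real. \<forall>k :: nat. k \<ge> 1 \<longrightarrow> \<not> {- real k..real k} \<times> {b} \<subseteq> D) \<and>
           smooth_boundary D"
proof (intro exI conjI allI impI)
  show "bent_strip \<noteq> {}"
    using slanted_segment_in_bent_strip[of 0 0] by auto
  show "bent_strip \<subseteq> {(x1, x2). x2 > 0}"
  proof clarify
    fix x y assume "(x, y) \<in> bent_strip"
    then have "1 / (1 + (x - 1)\<^sup>2) < y" by (simp add: bent_strip_eq)
    moreover have "0 \<le> 1 / (1 + (x - 1)\<^sup>2)" by simp
    ultimately show "0 < y" by linarith
  qed
  show "\<not> {- real k..real k} \<times> {b} \<subseteq> bent_strip" if "k \<ge> 1" for b and k :: nat
  proof
    assume "{- real k..real k} \<times> {b} \<subseteq> bent_strip"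
    moreover have "(1, b) \<in> {- real k..real k} \<times> {b}" "(- 1, b) \<in> {- real k..real k} \<times> {b}"
      using that by auto
    ultimately have "(1, b) \<in> bent_strip" "(- 1, b) \<in> bent_strip" by blast+
    \<comment> \<open>The lower graph at 1 forces \<open>b > 1\<close>, the upper graph at -1 forces
      \<open>b < 1\<close>.\<close>
    then show False by (simp add: bent_strip_eq)
  qed
qed (fact open_bent_strip connected_bent_strip not_kobayashi_hyperbolic_bent_strip
    smooth_boundary_bent_strip)+

end
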